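(* Let $G=(V,E)$ be a finite undirected graph and let $\mathcal P_R$ and $\mathcal P_B$ be two partitions of $V$ such that the clustered graph $(G,\mathcal P_R\cup\mathcal P_B)$ is c-co-connected. Let $\mathcal P'_I$ be the connected intersection partition of $\mathcal P_R$ and $\mathcal P_B$. Then $(G,\mathcal P_R\cup\mathcal P_B)$ is c-planar if and only if $(G,\mathcal P'_I)$ is c-planar.
   Context: An (overlapping) clustered graph $(G=(V,E),\mathcal C)$ consists of an undirected graph $G$ and a set $\mathcal C$ of clusters, i.e. subsets of $V$ (a vertex may lie in several clusters and clusters may overlap). For $C\subseteq V$, $G[C]$ denotes the induced subgraph. $(G,\mathcal C)$ is c-connected if $G[C]$ is connected for every $C\in\mathcal C$, and c-co-connected if both $G[C]$ and $G[V\setminus C]$ are connected for every $C\in\mathcal C$. If $(G,\mathcal C)$ is c-connected, a c-planar embedding of $G$ for $\mathcal C$ is a planar embedding of $G$ (with a designated outer face) such that for every $C\in\mathcal C$ all vertices of $V\setminus C$ lie in the outer face of the embedded subgraph $G[C]$. A graph $G^+=(V,E^+)$ is a c-planar support of $(G,\mathcal C)$ if $E\subseteq E^+$, $(G^+,\mathcal C)$ is c-connected, and $G^+$ has a c-planar embedding for $\mathcal C$. A clustered graph is c-planar if it has a c-planar support. For partitions $\mathcal P_B=\{B_1,\dots,B_{\ell_B}\}$ and $\mathcal P_R=\{R_1,\dots,R_{\ell_R}\}$ of $V$, the intersection partition is $\mathcal P_I=\{B_i\cap R_j\}$ (nonempty sets), and the connected intersection partition is the partition of $V$ into the vertex sets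 of the connected components of the graphs $G[C]$, $C\in\mathcal P_I$. The cluster set $\mathcal P_R\cup\mathcal P_B$ is the union of the two families of sets. *)

theory Defs
  imports "HOL-Analysis.Analysis" "HOL-Library.Disjoint_Sets"
begin

definition graph :: "'a set \<Rightarrow> 'a set set \<Rightarrow> bool" where
  "graph V E \<longleftrightarrow> finite V \<and> (\<forall>e\<in>E. \<exists>u v. e = {u, v} \<and> u \<noteq> v \<and> u \<in> V \<and> v \<in> V)"

definition induced_edges :: "'a set set \<Rightarrow> 'a set \<Rightarrow> 'a set set" where
  "induced_edges E C = {e \<in> E. e \<subseteq> C}"

definition reach_in :: "'a set set \<Rightarrow> 'a set \<Rightarrow> 'a \<Rightarrow> 'a \<Rightarrow> bool" where
  "reach_in E C = (\<lambda>x y. {x, y} \<in> E \<and> x \<in> C \<and> y \<in> C)\<^sup>*\<^sup>*"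

text \<open>G[C] is connected (the empty graph counts as connected).\<close>
definition connected_in :: "'a set set \<Rightarrow> 'a set \<Rightarrow> bool" where
  "connected_in E C \<longleftrightarrow> (\<forall>x\<in>C. \<forall>y\<in>C. reach_in E C x y)"

definition c_connected :: "'a set \<Rightarrow> 'a set set \<Rightarrow> 'a set set \<Rightarrow> bool" where
  "c_connected V E \<C> \<longleftrightarrow> (\<forall>C\<in>\<C>. connected_in E C)"

definition c_co_connected :: "'a set \<Rightarrow> 'a set set \<Rightarrow> 'a set set \<Rightarrow> bool" where
  "c_co_connected V E \<C> \<longleftrightarrow> (\<forall>C\<in>\<C>. connected_in E C \<and> connected_in E (V - C))"

definition planar_drawing ::
  "'a set \<Rightarrow> 'a set set \<Rightarrow> ('a \<Rightarrow> complex) \<Rightarrow> ('a set \<Rightarrow> real \<Rightarrow> complex) \<Rightarrow> bool" where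
  "planar_drawing V E pos curve \<longleftrightarrow>
     inj_on pos V \<and>
     (\<forall>e\<in>E. arc (curve e) \<and> {pathstart (curve e), pathfinish (curve e)} = pos ` e
            \<and> path_image (curve e) \<inter> pos ` V \<subseteq> pos ` e) \<and>
     (\<forall>e\<in>E. \<forall>e'\<in>E. e \<noteq> e' \<longrightarrow>
            path_image (curve e) \<inter> path_image (curve e') \<subseteq> pos ` (e \<inter> e'))"

definition drawing_of ::
  "'a set set \<Rightarrow> ('a \<Rightarrow> complex) \<Rightarrow> ('a set \<Rightarrow> real \<Rightarrow> complex) \<Rightarrow> 'a set \<Rightarrow> complex set" where
  "drawing_of E pos curve C = pos ` C \<union> (\<Union>e\<in>induced_edges E C. path_image (curve e))"

definition c_planar_embedding ::
  "'a set \<Rightarrow> 'a set set \<Rightarrow> 'a set set \<Rightarrow> ('a \<Rightarrow> complex) \<Rightarrow> ('a set \<Rightarrow> real \<Rightarrow> complex) \<Rightarrow> bool" where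
  "c_planar_embedding V E \<C> pos curve \<longleftrightarrow>
     planar_drawing V E pos curve \<and>
     (\<forall>C\<in>\<C>. \<forall>v\<in>V - C. pos v \<in> outside (drawing_of E pos curve C))"

definition c_planar_support :: "'a set \<Rightarrow> 'a set set \<Rightarrow> 'a set set \<Rightarrow> 'a set set \<Rightarrow> bool" where
  "c_planar_support V E \<C> Eplus \<longleftrightarrow>
     graph V Eplus \<and> E \<subseteq> Eplus \<and> c_connected V Eplus \<C> \<and>
     (\<exists>pos curve. c_planar_embedding V Eplus \<C> pos curve)"

definition c_planar :: "'a set \<Rightarrow> 'a set set \<Rightarrow> 'a set set \<Rightarrow> bool" where
  "c_planar V E \<C> \<longleftrightarrow> (\<exists>Eplus. c_planar_support V E \<C> Eplus)"

definition intersection_partition :: "'a set set \<Rightarrow> 'a set set \<Rightarrow> 'a set set" where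
  "intersection_partition PB PR = {B \<inter> R | B R. B \<in> PB \<and> R \<in> PR \<and> B \<inter> R \<noteq> {}}"

definition components_in :: "'a set set \<Rightarrow> 'a set \<Rightarrow> 'a set set" where
  "components_in E C = {{y \<in> C. reach_in E C x y} | x. x \<in> C}"

definition connected_intersection_partition ::
  "'a set set \<Rightarrow> 'a set set \<Rightarrow> 'a set set \<Rightarrow> 'a set set" where
  "connected_intersection_partition E PB PR =
     (\<Union>C\<in>intersection_partition PB PR. components_in E C)"

end

theory Submission
  imports Defs
begin

text \<open>
  Every cluster of either family is already connected in \<open>G\<close>, so in each direction the support may be
  taken to be \<open>G\<close> itself. A drawing that is c-planar for both partitions is c-planar for the connected
  intersection partition: a vertex of \<open>B \<inter> R\<close> enclosed by another component \<open>K\<close> of \<open>G[B \<inter> R]\<close> reaches \<open>K\<close>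
  inside \<open>G[B]\<close>, and the last vertex before \<open>K\<close> lies outside \<open>R\<close>, hence in the outer face.

  Conversely, let \<open>D\<^sub>C\<close> be the face of \<open>G[C]\<close> containing \<open>V - C\<close>. If all \<open>D\<^sub>C\<close> have a common point, it can be
  moved off the drawing, and inverting the plane at it makes every \<open>D\<^sub>C\<close> the outer face. Otherwise the closed
  sets \<open>- D\<^sub>C\<close> cover the plane. They are pairwise disjoint within each partition and none of
  them separates the plane, so by Janiszewski's theorem already two of them, \<open>- D\<^sub>B\<close> and \<open>- D\<^sub>R\<close>, cover it.
  Then the boundary of \<open>D\<^sub>B\<close> is contained in the drawing of \<open>G[B \<inter> R]\<close>, which therefore separates \<open>V - B\<close>
  from \<open>V - R\<close>. By Janiszewski again a single component of \<open>G[B \<inter> R]\<close> does so, and that component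
  does not have both vertices in its outer face.
\<close>

section \<open>Plane topology\<close>

text \<open>One member \<open>K\<close> meeting \<open>S\<close> and the union of the other members
  are disjoint closed sets covering \<open>S\<close>, and connectedness rules out that
  \<open>S\<close> meets both.\<close>

lemma connected_subset_disjoint_closed_Union:
  assumes "finite \<F>" "\<And>K. K \<in> \<F> \<Longrightarrow> closed K" "pairwise disjnt \<F>"
    and "connected S" "S \<subseteq> \<Union>\<F>" "S \<noteq> {}"
  shows "\<exists>K\<in>\<F>. S \<subseteq> K"
proof -
  obtain x K where x: "x \<in> S" "x \<in> K" "K \<in> \<F>"
    using assms by blast
  have "K \<inter> \<Union>(\<F> - {K}) = {}"
    using assms(3) \<open>K \<in> \<F>\<close> by (auto simp: pairwise_def disjnt_def)
  moreover have "closed (\<Union>(\<F> - {K}))"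
    using assms by auto
  moreover have "S \<subseteq> K \<union> \<Union>(\<F> - {K})"
    using assms by blast
  ultimately have "K \<inter> S = {} \<or> \<Union>(\<F> - {K}) \<inter> S = {}"
    using connected_closedD[OF \<open>connected S\<close>, of K "\<Union>(\<F> - {K})"] assms(2)[OF x(3)] by simp
  with x \<open>S \<subseteq> K \<union> \<Union>(\<F> - {K})\<close> show ?thesis
    by blast
qed

text \<open>Janiszewski's theorem iterated over a finite family: disjointness makes the intersection
  at each step empty, hence connected. At most one member fails to be compact, so either the new set
  or the union of the earlier ones is compact, as the theorem demands.\<close>

lemma connected_component_Compl_Union:
  fixes a b :: complex
  assumes "finite \<F>" "\<And>K. K \<in> \<F> \<Longrightarrow> closed K" "pairwise disjnt \<F>"
    and "\<And>K L. K \<in> \<F> \<Longrightarrow> L \<in> \<F> \<Longrightarrow> K \<noteq> L \<Longrightarrow> compact K \<or> compact L"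
    and "\<And>K. K \<in> \<F> \<Longrightarrow> connected_component (- K) a b"
  shows "connected_component (- \<Union>\<F>) a b"
  using assms
proof (induction \<F> rule: finite_induct)
  case empty
  then show ?case
    unfolding connected_component_def using connected_UNIV by blast
next
  case (insert K \<F>)
  have IH: "connected_component (- \<Union>\<F>) a b"
  proof (rule insert.IH)
    show "compact K \<or> compact L" if "K \<in> \<F>" "L \<in> \<F>" "K \<noteq> L" for K L
      using that insert.prems(3) by blast
  qed (use insert.prems in \<open>auto simp: pairwise_insert\<close>)
  have disj: "K \<inter> \<Union>\<F> = {}"
    using insert.prems(2) insert.hyps(2) by (fastforce simp: pairwise_def disjnt_def)
  show ?case
  proof (cases "compact K")
    case True
    have "closed (\<Union>\<F>)"
      using insert by auto
    then show ?thesis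
      using Janiszewski[OF True, of "\<Union>\<F>" a b] disj IH insert.prems(4) by auto
  next
    case False
    then have "compact (\<Union>\<F>)"
      using insert.prems(3) insert.hyps by (intro compact_Union) auto
    then show ?thesis
      using Janiszewski[of "\<Union>\<F>" K a b] disj IH insert.prems(1,4)
      by (auto simp: Int_commute Un_commute)
  qed
qed

text \<open>By Janiszewski the complement of \<open>\<Union>\<F>\<close> is connected; being covered
  by disjoint closed sets, it lies in a single \<open>L\<close>. The connected set
  \<open>- L\<close> is then covered by \<open>\<F>\<close> and lies in a single
  \<open>K\<close>.\<close>

lemma covering_by_two_of_two_disjoint_families:
  fixes \<F> \<G> :: "complex set set"
  assumes fin: "finite \<F>" "finite \<G>"
    and clo: "\<And>K. K \<in> \<F> \<union> \<G> \<Longrightarrow> closed K"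
    and con: "\<And>K. K \<in> \<F> \<union> \<G> \<Longrightarrow> connected (- K)"
    and ne: "\<And>K. K \<in> \<F> \<union> \<G> \<Longrightarrow> K \<noteq> UNIV"
    and disj: "pairwise disjnt \<F>" "pairwise disjnt \<G>"
    and com: "\<And>K L. K \<in> \<F> \<Longrightarrow> L \<in> \<F> \<Longrightarrow> K \<noteq> L \<Longrightarrow> compact K \<or> compact L"
    and cover: "\<Union>\<F> \<union> \<Union>\<G> = UNIV"
  shows "\<exists>K\<in>\<F>. \<exists>L\<in>\<G>. K \<union> L = UNIV"
proof -
  have "connected (- \<Union>\<F>)"
    unfolding connected_iff_connected_component
  proof (intro ballI)
    fix a b assume ab: "a \<in> - \<Union>\<F>" "b \<in> - \<Union>\<F>"
    show "connected_component (- \<Union>\<F>) a b"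
    proof (rule connected_component_Compl_Union)
      show "connected_component (- K) a b" if "K \<in> \<F>" for K
        using con[of K] that ab by (auto simp: connected_iff_connected_component)
    qed (use fin clo disj com in auto)
  qed
  \<comment> \<open>Otherwise the connected plane would itself lie in one member of
    \<open>\<F>\<close>.\<close>
  moreover have "- \<Union>\<F> \<noteq> {}"
  proof
    assume "- \<Union>\<F> = {}"
    then have "\<exists>K\<in>\<F>. UNIV \<subseteq> K"
      by (intro connected_subset_disjoint_closed_Union) (use fin clo disj in auto)
    then show False
      using ne by blast
  qed
  ultimately obtain L where L: "L \<in> \<G>" "- \<Union>\<F> \<subseteq> L"
    using connected_subset_disjoint_closed_Union[of \<G> "- \<Union>\<F>"] fin clo disj cover by blast
  then have "- L \<subseteq> \<Union>\<F>" "- L \<noteq> {}"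
    using ne[of L] by auto
  then obtain K where "K \<in> \<F>" "- L \<subseteq> K"
    using connected_subset_disjoint_closed_Union[of \<F> "- L"] fin clo disj con[of L] L by blast
  with L show ?thesis
    by blast
qed

text \<open>The inverse of the parametrization would embed a nonempty open subset of the plane into
  the line, against invariance of dimension.\<close>

lemma interior_arc_image:
  fixes g :: "real \<Rightarrow> complex"
  assumes "arc g"
  shows "interior (path_image g) = {}"
proof (rule ccontr)
  assume ne: "interior (path_image g) \<noteq> {}"
  obtain h where h: "homeomorphism {0..1} (path_image g) g h"
    using homeomorphism_arc[OF assms] .
  have "continuous_on (interior (path_image g)) h"
    using h interior_subset by (metis continuous_on_subset homeomorphism_def)
  moreover have "inj_on h (interior (path_image g))"
    using h interior_subset by (metis homeomorphism_def inj_on_inverseI subset_iff)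
  ultimately have "DIM(complex) \<le> DIM(real)"
    using ne by (intro invariance_of_dimension) auto
  then show False
    by simp
qed

lemma connected_arc_image_minus_end:
  assumes "arc g" "x = pathstart g \<or> x = pathfinish g"
  shows "connected (path_image g - {x})"
proof -
  have *: "connected (path_image g - {pathstart g})" if "arc g" for g :: "real \<Rightarrow> 'a"
  proof -
    have "path_image g - {pathstart g} = g ` {0<..1}"
    proof -
      have "inj_on g {0..1}"
        using that by (simp add: arc_def)
      then have "g ` ({0..1} - {0}) = g ` {0..1} - g ` {0}"
        by (intro inj_on_image_set_diff) auto
      moreover have "{0..1} - {0} = {0<..1::real}"
        by auto
      ultimately show ?thesis
        by (simp add: path_image_def pathstart_def)
    qed
    moreover have "continuous_on {0<..1} g"
      using that unfolding arc_def path_def by (auto intro: continuous_on_subset)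
    ultimately show ?thesis
      by (simp add: connected_continuous_image)
  qed
  show ?thesis
    using assms(2) *[OF assms(1)] *[OF arc_reversepath[OF assms(1)]] by auto
qed

text \<open>Puncturing the open connected set \<open>U\<close> at \<open>p\<close> keeps it
  connected, and points of \<open>U\<close> close to \<open>p\<close> are sent arbitrarily far away.
  So the image of \<open>x\<close> lies in an unbounded component.\<close>

lemma outside_image_inversion:
  fixes p x :: complex
  assumes "open U" "connected U" "p \<in> U" "x \<in> U" "x \<noteq> p" "U \<inter> X = {}"
  shows "inverse (x - p) \<in> outside ((\<lambda>z. inverse (z - p)) ` X)"
proof -
  let ?f = "\<lambda>z. inverse (z - p)"
  have conn: "connected (?f ` (U - {p}))"
  proof (rule connected_continuous_image)
    show "continuous_on (U - {p}) ?f"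
      by (intro continuous_intros) auto
    show "connected (U - {p})"
      using connected_open_delete_finite[of U "{p}"] assms by auto
  qed
  have sub: "?f ` (U - {p}) \<subseteq> - ?f ` X"
    using assms(6) by auto
  have "\<exists>y. B < norm y \<and> connected_component (- ?f ` X) (?f x) y" for B
  proof -
    obtain e where e: "e > 0" "ball p e \<subseteq> U"
      using assms(1,3) open_contains_ball by blast
    \<comment> \<open>The first bound keeps \<open>p + d\<close> inside \<open>U\<close>; the second
      makes the norm of its image, \<open>1 / d\<close>, exceed \<open>B\<close>.\<close>
    define d where "d = min (e / 2) (1 / (\<bar>B\<bar> + 1))"
    have d: "0 < d" "d < e" "d \<le> 1 / (\<bar>B\<bar> + 1)"
      using e by (auto simp: d_def)
    define y where "y = p + of_real d"
    have "y \<in> U - {p}"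
      using d e by (auto simp: y_def dist_norm subset_iff)
    moreover have "B < norm (?f y)"
    proof -
      have "\<bar>B\<bar> + 1 \<le> 1 / d"
        using d by (simp add: field_simps)
      then show ?thesis
        using d by (simp add: y_def norm_inverse inverse_eq_divide norm_divide)
    qed
    ultimately show ?thesis
      unfolding connected_component_def using conn sub assms(4,5) by blast
  qed
  then show ?thesis
    unfolding outside_connected_component_lt by simp
qed

section \<open>Clustered graphs\<close>

lemma reach_in_sym: "reach_in E C x y \<Longrightarrow> reach_in E C y x"
  unfolding reach_in_def
  by (rule sympD[OF symp_rtranclp]) (auto simp: symp_def insert_commute)

lemma reach_in_trans: "reach_in E C x y \<Longrightarrow> reach_in E C y z \<Longrightarrow> reach_in E C x z"
  unfolding reach_in_def by (rule rtranclp_trans)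

text \<open>A walk in \<open>C\<close> starting in a component never leaves it, since each vertex on
  the walk is reachable from the start.\<close>

lemma connected_in_component:
  assumes "K \<in> components_in E C"
  shows "connected_in E K"
proof -
  obtain x where x: "x \<in> C" and K: "K = {y \<in> C. reach_in E C x y}"
    using assms by (auto simp: components_in_def)
  have *: "reach_in E K x y" if "reach_in E C x y" for y
    using that unfolding reach_in_def
  proof (induction rule: rtranclp_induct)
    case (step y z)
    have "reach_in E C x y" "reach_in E C x z"
      using step.hyps unfolding reach_in_def by (auto intro: rtranclp.rtrancl_into_rtrancl)
    then have "{y, z} \<in> E \<and> y \<in> K \<and> z \<in> K"
      using step.hyps by (simp add: K)
    with step.IH show ?case
      by (rule rtranclp.rtrancl_into_rtrancl)
  qed simp
  have "reach_in E K x y" if "y \<in> K" for y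
    using * that by (simp add: K)
  then show ?thesis
    unfolding connected_in_def using reach_in_sym reach_in_trans by metis
qed

lemma Union_components_in: "\<Union>(components_in E C) = C"
  by (auto simp: components_in_def reach_in_def)

lemma pairwise_disjnt_components_in: "pairwise disjnt (components_in E C)"
  unfolding pairwise_def
proof (intro ballI impI)
  fix K L assume "K \<in> components_in E C" "L \<in> components_in E C" and ne: "K \<noteq> L"
  then obtain x y where K: "K = {z \<in> C. reach_in E C x z}" and L: "L = {z \<in> C. reach_in E C y z}"
    unfolding components_in_def by blast
  show "disjnt K L"
  proof (rule ccontr)
    assume "\<not> disjnt K L"
    then obtain z where "reach_in E C x z" "reach_in E C y z"
      unfolding K L disjnt_def by blast
    then have xy: "reach_in E C x y"
      using reach_in_sym reach_in_trans by metis
    have "reach_in E C x = reach_in E C y"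
      using reach_in_trans[OF xy] reach_in_trans[OF reach_in_sym[OF xy]] by (intro ext iffI)
    with ne show False
      unfolding K L by simp
  qed
qed

lemma component_absorbs_edge:
  assumes "K \<in> components_in E C" "{x, y} \<in> E" "x \<in> K" "y \<in> C"
  shows "y \<in> K"
proof -
  obtain c where c: "c \<in> C" and K: "K = {y \<in> C. reach_in E C c y}"
    using assms by (auto simp: components_in_def)
  have "x \<in> C"
    using assms(3) K by blast
  then have "reach_in E C x y"
    unfolding reach_in_def using assms(2,4) by (intro r_into_rtranclp) simp
  moreover have "reach_in E C c x"
    using assms(3) K by blast
  ultimately show ?thesis
    using K assms(4) reach_in_trans[of E C c x y] by simp
qed

lemma drawing_of_cases [consumes 1, case_names vertex edge]:
  assumes "z \<in> drawing_of E pos curve C"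
  obtains v where "v \<in> C" "z = pos v"
  | e where "e \<in> E" "e \<subseteq> C" "z \<in> path_image (curve e)"
  using assms unfolding drawing_of_def induced_edges_def by blast

lemma drawing_of_mono:
  "E \<subseteq> E' \<Longrightarrow> C \<subseteq> C' \<Longrightarrow> drawing_of E pos curve C \<subseteq> drawing_of E' pos curve C'"
  unfolding drawing_of_def induced_edges_def by blast

text \<open>Deleting the extra edges of a support only enlarges the outer faces, so its drawing
  restricts to one of \<open>G\<close>; conversely \<open>G\<close> is its own support.\<close>

lemma c_planar_iff_embedding:
  assumes "graph V E" "c_connected V E \<C>"
  shows "c_planar V E \<C> \<longleftrightarrow> (\<exists>pos curve. c_planar_embedding V E \<C> pos curve)"
proof
  assume "c_planar V E \<C>"
  then obtain E' pos curve where E': "E \<subseteq> E'" and emb: "c_planar_embedding V E' \<C> pos curve"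
    unfolding c_planar_def c_planar_support_def by blast
  have "planar_drawing V E pos curve"
    using emb E' unfolding c_planar_embedding_def planar_drawing_def by (meson subsetD)
  moreover have "outside (drawing_of E' pos curve C) \<subseteq> outside (drawing_of E pos curve C)" for C
    by (intro outside_mono drawing_of_mono E' order_refl)
  ultimately have "c_planar_embedding V E \<C> pos curve"
    using emb unfolding c_planar_embedding_def by blast
  then show "\<exists>pos curve. c_planar_embedding V E \<C> pos curve"
    by blast
next
  assume "\<exists>pos curve. c_planar_embedding V E \<C> pos curve"
  then show "c_planar V E \<C>"
    unfolding c_planar_def c_planar_support_def using assms by blast
qed

section \<open>Plane graphs\<close>

locale plane_graph =
  fixes V :: "'a set" and E :: "'a set set"
    and pos :: "'a \<Rightarrow> complex" and curve :: "'a set \<Rightarrow> real \<Rightarrow> complex"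
  assumes graph: "graph V E" and drawing: "planar_drawing V E pos curve"
begin

abbreviation X :: "'a set \<Rightarrow> complex set" where
  "X \<equiv> drawing_of E pos curve"

section \<open>Basic properties of drawn vertices, edges and subgraphs\<close>

lemma finite_V: "finite V"
  using graph by (simp add: graph_def)

lemma edgeE:
  assumes "e \<in> E"
  obtains u v where "e = {u, v}" "u \<noteq> v" "u \<in> V" "v \<in> V"
    "pathstart (curve e) = pos u" "pathfinish (curve e) = pos v"
proof -
  obtain u v where uv: "e = {u, v}" "u \<noteq> v" "u \<in> V" "v \<in> V"
    using graph assms unfolding graph_def by blast
  have "{pathstart (curve e), pathfinish (curve e)} = {pos u, pos v}"
    using drawing assms uv(1) unfolding planar_drawing_def by auto
  then have "pathstart (curve e) = pos u \<and> pathfinish (curve e) = pos v \<or>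
      pathstart (curve e) = pos v \<and> pathfinish (curve e) = pos u"
    by (auto simp: doubleton_eq_iff)
  then show thesis
    using that[of u v] that[of v u] uv by (metis insert_commute)
qed

lemma edge_subset: "e \<in> E \<Longrightarrow> e \<subseteq> V"
  by (elim edgeE) auto

lemma finite_E: "finite E"
  using edge_subset finite_V by (meson Sup_least finite_UnionD finite_subset)

lemma arc_curve: "e \<in> E \<Longrightarrow> arc (curve e)"
  using drawing by (auto simp: planar_drawing_def)

lemma inj_pos: "inj_on pos V"
  using drawing by (auto simp: planar_drawing_def)

lemma curve_Int_pos: "e \<in> E \<Longrightarrow> path_image (curve e) \<inter> pos ` V \<subseteq> pos ` e"
  using drawing by (auto simp: planar_drawing_def)

lemma curve_Int_curve:
  "e \<in> E \<Longrightarrow> e' \<in> E \<Longrightarrow> e \<noteq> e' \<Longrightarrow> path_image (curve e) \<inter> path_image (curve e') \<subseteq> pos ` (e \<inter> e')"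
  using drawing unfolding planar_drawing_def by meson

lemma pos_in_curve: "e \<in> E \<Longrightarrow> v \<in> e \<Longrightarrow> pos v \<in> path_image (curve e)"
  by (elim edgeE) (metis insertE pathfinish_in_path_image pathstart_in_path_image singletonD)

lemma compact_drawing:
  assumes "C \<subseteq> V"
  shows "compact (X C)"
  unfolding drawing_of_def induced_edges_def using assms finite_V finite_E arc_curve
  by (intro compact_Un compact_UN finite_imp_compact[OF finite_imageI])
     (auto simp: finite_subset intro: compact_arc_image)

lemma open_Compl_drawing: "C \<subseteq> V \<Longrightarrow> open (- X C)"
  using compact_drawing compact_imp_closed by auto

text \<open>A drawing is a finite union of closed sets with empty interior. This later allows a
  point to be moved off the drawing within an open set.\<close>

lemma interior_drawing:
  assumes "C \<subseteq> V"
  shows "interior (X C) = {}"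
proof -
  have "interior (pos ` C \<union> (\<Union>e\<in>F. path_image (curve e))) = {}" if "finite F" "F \<subseteq> E" for F
    using that
  proof (induction F rule: finite_induct)
    case empty
    then show ?case
      using assms finite_V by (simp add: empty_interior_finite finite_subset)
  next
    case (insert e F)
    have "closed (pos ` C \<union> (\<Union>e\<in>F. path_image (curve e)))"
      using insert.hyps insert.prems assms finite_V arc_curve
      by (intro closed_Un closed_UN finite_imp_closed[OF finite_imageI])
         (auto simp: finite_subset intro: closed_arc_image)
    from interior_closed_Un_empty_interior[OF this interior_arc_image[of "curve e"]]
    show ?case
      using insert arc_curve by (simp add: Un_ac)
  qed
  then show ?thesis
    using finite_E unfolding drawing_of_def induced_edges_def by auto
qed

text \<open>A vertex on the curve is an end of \<open>e\<close>, and an edge of \<open>G[C]\<close>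
  differs from \<open>e\<close>, so it can meet the curve only in a shared end.\<close>

lemma curve_Int_drawing:
  assumes "e \<in> E" "C \<subseteq> V" "\<not> e \<subseteq> C"
  shows "path_image (curve e) \<inter> X C \<subseteq> pos ` (e \<inter> C)"
proof
  fix z assume z: "z \<in> path_image (curve e) \<inter> X C"
  then consider v where "v \<in> C" "z = pos v"
    | e' where "e' \<in> E" "e' \<subseteq> C" "z \<in> path_image (curve e')"
    unfolding drawing_of_def induced_edges_def by blast
  then show "z \<in> pos ` (e \<inter> C)"
  proof cases
    case (1 v)
    then have "pos v \<in> pos ` e"
      using curve_Int_pos[OF assms(1)] z assms(2) by blast
    then have "v \<in> e"
      using inj_pos edge_subset[OF assms(1)] assms(2) 1
      by (meson inj_on_image_mem_iff subsetD)
    with 1 show ?thesis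
      by blast
  next
    case (2 e')
    then show ?thesis
      using curve_Int_curve[OF assms(1), of e'] z assms(3) by blast
  qed
qed

lemma pos_notin_drawing:
  assumes "C \<subseteq> V" "v \<in> V - C"
  shows "pos v \<notin> X C"
proof
  assume "pos v \<in> X C"
  then consider "pos v \<in> pos ` C" | e where "e \<in> E" "e \<subseteq> C" "pos v \<in> pos ` e"
    using curve_Int_pos assms(2) unfolding drawing_of_def induced_edges_def by blast
  then have "pos v \<in> pos ` C"
    by cases auto
  then show False
    using inj_pos assms by (meson DiffD1 DiffD2 inj_on_image_mem_iff)
qed

section \<open>Connectivity in the graph and in the plane\<close>

text \<open>As \<open>w\<close> is outside \<open>C\<close>, at most one end of \<open>e\<close>
  lies in \<open>C\<close>; an arc without one end is still connected, and what remains avoids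
  \<open>X C\<close>.\<close>

lemma curve_subset_connected_component:
  assumes "e \<in> E" "C \<subseteq> V" "w \<in> e - C"
  shows "path_image (curve e) - pos ` (e \<inter> C) \<subseteq> connected_component_set (- X C) (pos w)"
proof (rule connected_component_maximal)
  have "w \<in> V"
    using assms edge_subset by blast
  show "pos w \<in> path_image (curve e) - pos ` (e \<inter> C)"
    using assms pos_in_curve[of e w] inj_on_image_mem_iff[OF inj_pos \<open>w \<in> V\<close>, of "e \<inter> C"] by auto
  show "path_image (curve e) - pos ` (e \<inter> C) \<subseteq> - X C"
    using curve_Int_drawing[OF assms(1,2)] assms(3) by blast
  obtain u v where uv: "e = {u, v}"
    and ends: "pathstart (curve e) = pos u" "pathfinish (curve e) = pos v"
    using edgeE[OF assms(1)] by metis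
  have arc: "arc (curve e)"
    by (rule arc_curve[OF assms(1)])
  consider "e \<inter> C = {}" | x where "e \<inter> C = {x}" "x = u \<or> x = v"
    using uv assms(3) by auto
  then show "connected (path_image (curve e) - pos ` (e \<inter> C))"
  proof cases
    case 1
    then show ?thesis
      using arc by (simp add: connected_arc_image)
  next
    case (2 x)
    then have "connected (path_image (curve e) - {pos x})"
      using connected_arc_image_minus_end[OF arc] ends by metis
    with 2 show ?thesis
      by simp
  qed
qed

lemma reach_in_imp_connected_component:
  assumes "C \<subseteq> V" "u \<in> V - C" "reach_in E (V - C) u v"
  shows "connected_component (- X C) (pos u) (pos v)"
  using assms(3) unfolding reach_in_def
proof (induction rule: rtranclp_induct)
  case base
  then show ?case
    using pos_notin_drawing[OF assms(1,2)] by simp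
next
  case (step y z)
  have yz: "{y, z} \<in> E" "y \<in> V - C" "z \<in> V - C"
    using step.hyps(2) by auto
  then have "pos z \<in> path_image (curve {y, z}) - pos ` ({y, z} \<inter> C)"
    using pos_in_curve[of "{y, z}" z] by auto
  then have "connected_component (- X C) (pos y) (pos z)"
    using curve_subset_connected_component[OF yz(1) assms(1), of y] yz(2) by auto
  with step.IH show ?case
    by (rule connected_component_trans)
qed

text \<open>Walks in \<open>G[C]\<close> connect the drawn vertices, and every point of a curve is
  connected to an end of its edge.\<close>

lemma connected_drawing:
  assumes "connected_in E C"
  shows "connected (X C)"
proof -
  have edge: "connected_component (X C) x y"
    if "e \<in> E" "e \<subseteq> C" "x \<in> path_image (curve e)" "y \<in> path_image (curve e)" for e x y
  proof -
    have "path_image (curve e) \<subseteq> X C"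
      using that(1,2) unfolding drawing_of_def induced_edges_def by blast
    then show ?thesis
      unfolding connected_component_def
      using that connected_arc_image[OF arc_curve[OF that(1)]] by blast
  qed
  have reach: "connected_component (X C) (pos u) (pos v)" if "reach_in E C u v" "u \<in> C" for u v
    using that(1) unfolding reach_in_def
  proof (induction rule: rtranclp_induct)
    case base
    show ?case
      using \<open>u \<in> C\<close> by (simp add: drawing_of_def)
  next
    case (step y z)
    have "connected_component (X C) (pos y) (pos z)"
      using step.hyps(2) by (intro edge[of "{y, z}"] pos_in_curve) auto
    with step.IH show ?case
      by (rule connected_component_trans)
  qed
  have vertex: "\<exists>v\<in>C. connected_component (X C) z (pos v)" if z: "z \<in> X C" for z
  proof -
    consider v where "v \<in> C" "z = pos v"
      | e where "e \<in> E" "e \<subseteq> C" "z \<in> path_image (curve e)"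
      using z unfolding drawing_of_def induced_edges_def by blast
    then show ?thesis
    proof cases
      case (1 v)
      then show ?thesis
        using z connected_component_refl by blast
    next
      case (2 e)
      obtain u where "u \<in> e"
        using edgeE[OF 2(1)] by blast
      then have "connected_component (X C) z (pos u)"
        using 2 by (intro edge[of e] pos_in_curve)
      with \<open>u \<in> e\<close> 2(2) show ?thesis
        by blast
    qed
  qed
  show ?thesis
    unfolding connected_iff_connected_component
  proof (intro ballI)
    fix x y assume "x \<in> X C" "y \<in> X C"
    then obtain u v where u: "u \<in> C" "connected_component (X C) x (pos u)"
      and v: "v \<in> C" "connected_component (X C) y (pos v)"
      using vertex by metis
    have "connected_component (X C) (pos u) (pos v)"
      using reach u(1) v(1) assms unfolding connected_in_def by blast
    then show "connected_component (X C) x y"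
      using u(2) v(2) connected_component_sym connected_component_trans by metis
  qed
qed

section \<open>The face of a cluster that holds the other vertices\<close>

text \<open>When \<open>G[V - C]\<close> is connected, this union is a single face of \<open>G[C]\<close>; it is empty for \<open>C = V\<close>.\<close>
definition coregion :: "'a set \<Rightarrow> complex set" where
  "coregion C = (\<Union>v\<in>V - C. connected_component_set (- X C) (pos v))"

lemma coregion_eq:
  assumes "C \<subseteq> V" "connected_in E (V - C)" "v \<in> V - C"
  shows "coregion C = connected_component_set (- X C) (pos v)"
proof -
  have "connected_component_set (- X C) (pos u) = connected_component_set (- X C) (pos v)"
    if "u \<in> V - C" for u
  proof (rule connected_component_eq)
    show "pos u \<in> connected_component_set (- X C) (pos v)"
      using reach_in_imp_connected_component[OF assms(1,3)] assms(2,3) that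
      unfolding connected_in_def by blast
  qed
  then show ?thesis
    unfolding coregion_def using assms(3) by blast
qed

lemma coregion_subset: "coregion C \<subseteq> - X C"
  unfolding coregion_def using connected_component_subset by blast

lemma open_coregion: "C \<subseteq> V \<Longrightarrow> open (coregion C)"
  unfolding coregion_def by (intro open_UN ballI open_connected_component open_Compl_drawing)

lemma pos_in_coregion:
  assumes "C \<subseteq> V" "v \<in> V - C"
  shows "pos v \<in> coregion C"
proof -
  have "pos v \<in> connected_component_set (- X C) (pos v)"
    using pos_notin_drawing[OF assms] by simp
  with assms(2) show ?thesis
    unfolding coregion_def by blast
qed

text \<open>An edge that leaves \<open>C\<close> runs in the coregion of \<open>C\<close> except at
  its ends in \<open>C\<close>.\<close>

lemma curve_subset_coregion:
  assumes "e \<in> E" "C \<subseteq> V" "\<not> e \<subseteq> C"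
  shows "path_image (curve e) - pos ` (e \<inter> C) \<subseteq> coregion C"
proof -
  obtain w where w: "w \<in> e - C"
    using assms(3) by blast
  then have "connected_component_set (- X C) (pos w) \<subseteq> coregion C"
    unfolding coregion_def using edge_subset[OF assms(1)] by blast
  then show ?thesis
    using curve_subset_connected_component[OF assms(1,2) w] by (rule order_trans[rotated])
qed

lemma drawing_subset_coregion:
  assumes "C \<subseteq> V" "C' \<subseteq> V" "C \<inter> C' = {}"
  shows "X C' \<subseteq> coregion C"
proof -
  have "path_image (curve e) \<subseteq> coregion C" if "e \<in> E" "e \<subseteq> C'" for e
  proof -
    have "e \<inter> C = {}" "e \<noteq> {}"
      using that assms(3) edgeE[OF that(1)] by blast+
    then show ?thesis
      using curve_subset_coregion[OF that(1) assms(1)] by auto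
  qed
  moreover have "pos ` C' \<subseteq> coregion C"
    using pos_in_coregion assms by blast
  ultimately show ?thesis
    unfolding drawing_of_def induced_edges_def by blast
qed

text \<open>The complement of a face of a connected drawing is connected. Here it contains
  \<open>X C\<close> and misses \<open>X C'\<close>, so it lies in the one face of
  \<open>G[C']\<close> that contains the vertices of \<open>C\<close>. Thus disjoint clusters yield
  disjoint closed sets \<open>- coregion C\<close>.\<close>

lemma coregions_cover:
  assumes "C \<subseteq> V" "C' \<subseteq> V" "C \<inter> C' = {}" "C \<noteq> {}" "C' \<noteq> {}"
    and "connected_in E C" "connected_in E (V - C)" "connected_in E (V - C')"
  shows "- coregion C \<subseteq> coregion C'"
proof -
  obtain c c' where c: "c \<in> C" "c' \<in> C'"
    using assms by blast
  then have v: "c' \<in> V - C" "c \<in> V - C'"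
    using assms by auto
  have "connected (- coregion C)"
  proof (rule component_complement_connected[OF connected_drawing[OF assms(6)]])
    show "coregion C \<in> components (- X C)"
      unfolding coregion_eq[OF assms(1,7) v(1)]
      using pos_notin_drawing[OF assms(1) v(1)] by (auto intro: componentsI)
  qed
  moreover have "pos c \<in> - coregion C"
    using coregion_subset[of C] c(1) by (auto simp: drawing_of_def)
  moreover have "- coregion C \<subseteq> - X C'"
    using drawing_subset_coregion[OF assms(1-3)] by blast
  ultimately show ?thesis
    unfolding coregion_eq[OF assms(2,8) v(2)] by (intro connected_component_maximal) auto
qed

text \<open>If \<open>coregion C'\<close> is bounded, so is its subset \<open>- coregion C\<close>.
  If not, it is the outer face of \<open>X C'\<close>, whose complement is bounded.\<close>

lemma compact_Compl_coregion_or: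
  assumes "C \<subseteq> V" "C' \<subseteq> V" "C' \<noteq> V" "connected_in E (V - C')"
    and "- coregion C \<subseteq> coregion C'"
  shows "compact (- coregion C) \<or> compact (- coregion C')"
proof (cases "bounded (coregion C')")
  case True
  then show ?thesis
    using assms(5) open_coregion[OF assms(1)] bounded_subset
    by (auto simp: compact_eq_bounded_closed)
next
  case False
  obtain v where v: "v \<in> V - C'"
    using assms by blast
  note eq = coregion_eq[OF assms(2,4) v]
  have bdd: "bounded (X C')"
    by (simp add: assms(2) compact_drawing compact_imp_bounded)
  have "outside (X C') \<subseteq> coregion C'"
    unfolding eq
  proof (rule connected_component_maximal)
    show "pos v \<in> outside (X C')"
      using False eq by (simp add: outside)
    show "connected (outside (X C'))"
      using bdd by (simp add: connected_outside)
    show "outside (X C') \<subseteq> - X C'"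
      by (auto simp: outside_def)
  qed
  then have "bounded (- coregion C')"
    by (meson bdd cobounded_outside Compl_subset_Compl_iff bounded_subset)
  then show ?thesis
    using open_coregion[OF assms(2)] by (auto simp: compact_eq_bounded_closed)
qed

lemma drawing_subset_components: "X C \<subseteq> (\<Union>K\<in>components_in E C. X K)"
proof
  fix z assume "z \<in> X C"
  then show "z \<in> (\<Union>K\<in>components_in E C. X K)"
  proof (cases rule: drawing_of_cases)
    case (vertex v)
    then obtain K where "K \<in> components_in E C" "v \<in> K"
      using Union_components_in[of E C] by blast
    then show ?thesis
      using vertex(2) by (auto simp: drawing_of_def)
  next
    case (edge e)
    obtain u v where uv: "e = {u, v}"
      using edgeE[OF edge(1)] by blast
    then obtain K where K: "K \<in> components_in E C" "u \<in> K"
      using edge(2) Union_components_in[of E C] by blast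
    then have "e \<subseteq> K"
      using component_absorbs_edge[of K E C u v] edge(1,2) uv by auto
    then have "z \<in> X K"
      using edge by (auto simp: drawing_of_def induced_edges_def)
    with K(1) show ?thesis
      by blast
  qed
qed

text \<open>A frontier point lies on \<open>X B\<close> and, by disjointness, not in the open set
  \<open>coregion R\<close>. But that set contains all vertices outside \<open>R\<close> and all
  curves of edges leaving \<open>R\<close>, up to their ends in \<open>R\<close>; only points of
  \<open>X (B \<inter> R)\<close> remain.\<close>

lemma frontier_coregion_subset:
  assumes "B \<subseteq> V" "R \<subseteq> V" "connected_in E (V - B)" "v \<in> V - B"
    and disj: "coregion B \<inter> coregion R = {}"
  shows "frontier (coregion B) \<subseteq> X (B \<inter> R)"
proof
  fix z assume z: "z \<in> frontier (coregion B)"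
  have "coregion B \<in> components (- X B)"
    unfolding coregion_eq[OF assms(1,3,4)]
    using pos_notin_drawing[OF assms(1,4)] by (auto intro: componentsI)
  then have "z \<in> X B"
    using frontier_of_components_closed_complement[of "X B"] z
      compact_imp_closed[OF compact_drawing[OF assms(1)]] by blast
  moreover have zR: "z \<notin> coregion R"
    using z disj open_Int_closure_eq_empty[OF open_coregion[OF assms(2)], of "coregion B"]
    by (auto simp: frontier_def)
  ultimately consider w where "w \<in> B" "z = pos w"
    | e where "e \<in> E" "e \<subseteq> B" "z \<in> path_image (curve e)"
    unfolding drawing_of_def induced_edges_def by blast
  then show "z \<in> X (B \<inter> R)"
  proof cases
    case (1 w)
    then have "w \<in> R"
      using zR pos_in_coregion[OF assms(2)] assms(1) by blast
    with 1 show ?thesis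
      by (auto simp: drawing_of_def)
  next
    case (2 e)
    show ?thesis
    proof (cases "e \<subseteq> R")
      case True
      with 2 show ?thesis
        by (auto simp: drawing_of_def induced_edges_def)
    next
      case False
      then have "z \<in> pos ` (e \<inter> R)"
        using curve_subset_coregion[OF 2(1) assms(2)] 2(3) zR by blast
      with 2(2) show ?thesis
        by (auto simp: drawing_of_def)
    qed
  qed
qed

section \<open>A common point of all coregions\<close>

text \<open>No single component drawing separates \<open>v\<close> from \<open>u\<close>, so by
  Janiszewski neither does their union. If the coregions were disjoint, a connecting set would have
  to cross the frontier of \<open>coregion B\<close>, which lies in that union.\<close>

lemma coregions_meet:
  assumes sub: "B \<subseteq> V" "R \<subseteq> V" and ne: "B \<noteq> V" "R \<noteq> V"
    and con: "connected_in E (V - B)"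
    and out: "\<And>K v. K \<in> components_in E (B \<inter> R) \<Longrightarrow> v \<in> V - K \<Longrightarrow> pos v \<in> outside (X K)"
  shows "coregion B \<inter> coregion R \<noteq> {}"
proof
  assume disj: "coregion B \<inter> coregion R = {}"
  obtain v u where v: "v \<in> V - B" and u: "u \<in> V - R"
    using sub ne by blast
  have KV: "K \<subseteq> B \<inter> R" if "K \<in> components_in E (B \<inter> R)" for K
    using that Union_components_in[of E "B \<inter> R"] by blast
  then have KV': "K \<subseteq> V" if "K \<in> components_in E (B \<inter> R)" for K
    using that sub by blast
  have compact: "compact (X K)" if "K \<in> components_in E (B \<inter> R)" for K
    by (rule compact_drawing[OF KV'[OF that]])
  have "connected_component (- \<Union>(X ` components_in E (B \<inter> R))) (pos v) (pos u)"
  proof (rule connected_component_Compl_Union)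
    have "finite (components_in E (B \<inter> R))"
      by (rule finite_subset[of _ "Pow V"]) (use KV' finite_V in auto)
    then show "finite (X ` components_in E (B \<inter> R))"
      by simp
    show "pairwise disjnt (X ` components_in E (B \<inter> R))"
    proof (clarsimp simp: pairwise_def)
      fix K L assume KL: "K \<in> components_in E (B \<inter> R)" "L \<in> components_in E (B \<inter> R)" "X K \<noteq> X L"
      then have "K \<inter> L = {}"
        using pairwise_disjnt_components_in unfolding pairwise_def disjnt_def by metis
      then have "X L \<subseteq> coregion K"
        by (intro drawing_subset_coregion KV' KL)
      then show "disjnt (X K) (X L)"
        using coregion_subset[of K] by (auto simp: disjnt_def)
    qed
    show "connected_component (- L) (pos v) (pos u)"
      if "L \<in> X ` components_in E (B \<inter> R)" for L
    proof -
      obtain K where K: "K \<in> components_in E (B \<inter> R)" and L: "L = X K"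
        using \<open>L \<in> _\<close> by blast
      have "pos v \<in> outside (X K)" "pos u \<in> outside (X K)"
        using out[OF K] u v KV[OF K] by auto
      moreover have "connected (outside (X K))"
        using compact[OF K] by (simp add: compact_imp_bounded connected_outside)
      moreover have "outside (X K) \<subseteq> - X K"
        by (auto simp: outside_def)
      ultimately show ?thesis
        unfolding connected_component_def L by blast
    qed
  qed (use compact in \<open>auto intro: compact_imp_closed\<close>)
  then obtain T where T: "connected T" "T \<subseteq> - \<Union>(X ` components_in E (B \<inter> R))"
      "pos v \<in> T" "pos u \<in> T"
    unfolding connected_component_def by blast
  \<comment> \<open>\<open>T\<close> contains \<open>pos v\<close> in \<open>coregion B\<close> and
    \<open>pos u\<close> in \<open>coregion R\<close>, hence outside
    \<open>coregion B\<close>.\<close>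
  have "T \<inter> frontier (coregion B) \<noteq> {}"
    using T v u pos_in_coregion sub disj by (intro connected_Int_frontier) blast+
  then show False
    using T(2) frontier_coregion_subset[OF sub con v disj] drawing_subset_components[of "B \<inter> R"]
    by blast
qed

text \<open>Without a common point the complements of the coregions cover the plane, hence two of
  them do, one from each partition; this contradicts \<open>coregions_meet\<close>. The cluster
  \<open>V\<close> is excluded because its coregion is empty.\<close>

lemma common_coregion_point:
  assumes "partition_on V PB" "partition_on V PR"
    and co: "c_co_connected V E (PR \<union> PB)"
    and out: "\<And>B R K v. B \<in> PB \<Longrightarrow> R \<in> PR \<Longrightarrow> K \<in> components_in E (B \<inter> R) \<Longrightarrow> v \<in> V - K
                \<Longrightarrow> pos v \<in> outside (X K)"
  shows "\<exists>p. \<forall>C\<in>PR \<union> PB - {V}. p \<in> coregion C"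
proof (rule ccontr)
  assume contra: "\<not> ?thesis"
  have sub: "C \<subseteq> V" and ne: "C \<noteq> {}" if "C \<in> PR \<union> PB" for C
    using assms(1,2) that unfolding partition_on_def by blast+
  have con: "connected_in E C" "connected_in E (V - C)" if "C \<in> PR \<union> PB" for C
    using co that unfolding c_co_connected_def by blast+
  define cl where "cl = (\<lambda>C. - coregion C)"
  have cover: "cl C \<inter> cl C' = {}" and compact: "compact (cl C) \<or> compact (cl C')"
    if "P = PB \<or> P = PR" "C \<in> P - {V}" "C' \<in> P - {V}" "C \<noteq> C'" for C C' P
  proof -
    have "disjoint P"
      using that(1) partition_onD2[OF assms(1)] partition_onD2[OF assms(2)] by blast
    then have "C \<inter> C' = {}"
      using that(2-4) by (intro disjointD) auto
    moreover have PP: "C \<in> PR \<union> PB" "C' \<in> PR \<union> PB" "C' \<noteq> V"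
      using that(1-3) by auto
    ultimately have cov: "- coregion C \<subseteq> coregion C'"
      by (intro coregions_cover sub ne con)
    then show "cl C \<inter> cl C' = {}"
      unfolding cl_def by blast
    show "compact (cl C) \<or> compact (cl C')"
      unfolding cl_def
      by (rule compact_Compl_coregion_or[OF sub[OF PP(1)] sub[OF PP(2)] PP(3) con(2)[OF PP(2)] cov])
  qed
  have eq: "\<exists>v. coregion C = connected_component_set (- X C) (pos v) \<and> pos v \<in> coregion C"
    if C: "C \<in> PR \<union> PB - {V}" for C
  proof -
    obtain v where v: "v \<in> V - C"
      using C sub by blast
    then show ?thesis
      using coregion_eq[of C v] pos_in_coregion[of C v] sub con C by blast
  qed
  have "\<exists>K\<in>cl ` (PB - {V}). \<exists>L\<in>cl ` (PR - {V}). K \<union> L = UNIV"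
  proof (rule covering_by_two_of_two_disjoint_families)
    have "finite (PR \<union> PB)"
      by (rule finite_subset[of _ "Pow V"]) (use sub finite_V in auto)
    then show "finite (cl ` (PB - {V}))" "finite (cl ` (PR - {V}))"
      by auto
    fix K assume "K \<in> cl ` (PB - {V}) \<union> cl ` (PR - {V})"
    then obtain C where C: "C \<in> PR \<union> PB - {V}" and K: "K = cl C"
      by blast
    show "closed K"
      using open_coregion sub C by (auto simp: K cl_def)
    show "connected (- K)" "K \<noteq> UNIV"
      using eq[OF C] by (auto simp: K cl_def)
  next
    show "pairwise disjnt (cl ` (PB - {V}))" "pairwise disjnt (cl ` (PR - {V}))"
      unfolding pairwise_def disjnt_def using cover by blast+
    show "compact K \<or> compact L" if "K \<in> cl ` (PB - {V})" "L \<in> cl ` (PB - {V})" "K \<noteq> L" for K L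
      using compact that by blast
    show "\<Union>(cl ` (PB - {V})) \<union> \<Union>(cl ` (PR - {V})) = UNIV"
      using contra by (auto simp: cl_def)
  qed
  then obtain B R where B: "B \<in> PB - {V}" and R: "R \<in> PR - {V}"
    and "coregion B \<inter> coregion R = {}"
    by (auto simp: cl_def)
  moreover have "coregion B \<inter> coregion R \<noteq> {}"
    using B R by (intro coregions_meet sub con out) auto
  ultimately show False
    by blast
qed

section \<open>Turning the coregions into outer faces by inversion\<close>

lemma c_planar_embedding_inversion:
  assumes p: "p \<notin> X V"
    and clusters: "\<And>C. C \<in> \<C> \<Longrightarrow> C \<subseteq> V \<and> connected_in E (V - C)"
    and coregion: "\<And>C. C \<in> \<C> \<Longrightarrow> C \<noteq> V \<Longrightarrow> p \<in> coregion C"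
  shows "\<exists>pos curve. c_planar_embedding V E \<C> pos curve"
proof -
  let ?f = "\<lambda>z. inverse (z - p)"
  let ?pos = "?f \<circ> pos" and ?curve = "\<lambda>e. ?f \<circ> curve e"
  \<comment> \<open>Since \<open>inverse 0 = 0\<close>, the map is injective on the whole plane,
    including \<open>p\<close>. It is discontinuous only at \<open>p\<close>, which the drawing
    avoids.\<close>
  have inj: "inj ?f"
    by (auto simp: inj_def)
  have pcurve: "p \<notin> path_image (curve e)" if "e \<in> E" for e
    using p that edge_subset by (auto simp: drawing_of_def induced_edges_def)
  have image: "path_image (?curve e) = ?f ` path_image (curve e)" for e
    by (simp add: path_image_compose)
  have "planar_drawing V E ?pos ?curve"
    unfolding planar_drawing_def
  proof (intro conjI ballI impI)
    show "inj_on ?pos V"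
      using inj_pos inj by (simp add: comp_inj_on inj_on_subset)
  next
    fix e assume e: "e \<in> E"
    have "continuous_on (path_image (curve e)) ?f"
      using pcurve[OF e] by (intro continuous_intros) auto
    then show "arc (?curve e)"
      using arc_curve[OF e] inj unfolding arc_def path_def path_image_def
      by (metis comp_inj_on continuous_on_compose inj_on_subset subset_UNIV)
    show "{pathstart (?curve e), pathfinish (?curve e)} = ?pos ` e"
    proof -
      have "{pathstart (curve e), pathfinish (curve e)} = pos ` e"
        using drawing e unfolding planar_drawing_def by meson
      from arg_cong[OF this, of "image ?f"] show ?thesis
        by (simp only: pathstart_compose pathfinish_compose image_insert image_empty image_comp)
    qed
    have "?f ` (path_image (curve e) \<inter> pos ` V) \<subseteq> ?f ` pos ` e"
      using curve_Int_pos[OF e] by (rule image_mono)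
    then show "path_image (?curve e) \<inter> ?pos ` V \<subseteq> ?pos ` e"
      unfolding image image_Int[OF inj] image_comp .
  next
    fix e e' assume "e \<in> E" "e' \<in> E" "e \<noteq> e'"
    then have "?f ` (path_image (curve e) \<inter> path_image (curve e')) \<subseteq> ?f ` pos ` (e \<inter> e')"
      by (intro image_mono curve_Int_curve)
    then show "path_image (?curve e) \<inter> path_image (?curve e') \<subseteq> ?pos ` (e \<inter> e')"
      unfolding image image_Int[OF inj] image_comp .
  qed
  moreover have "?pos v \<in> outside (drawing_of E ?pos ?curve C)" if "C \<in> \<C>" "v \<in> V - C" for C v
  proof -
    \<comment> \<open>The vertex \<open>v\<close> outside \<open>C\<close> witnesses
      \<open>C \<noteq> V\<close>, so the hypothesis on \<open>p\<close> applies.\<close>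
    have C: "C \<subseteq> V" "connected_in E (V - C)" "p \<in> coregion C"
      using clusters coregion that by blast+
    note eq = coregion_eq[OF C(1,2) that(2)]
    have "?f (pos v) \<in> outside (?f ` X C)"
    proof (rule outside_image_inversion)
      show "open (coregion C)" "p \<in> coregion C" "pos v \<in> coregion C"
        using open_coregion pos_in_coregion C that by auto
      show "connected (coregion C)"
        by (simp add: eq)
      show "pos v \<noteq> p"
        using p that by (auto simp: drawing_of_def)
      show "coregion C \<inter> X C = {}"
        using coregion_subset by blast
    qed
    moreover have "drawing_of E ?pos ?curve C = ?f ` X C"
      unfolding drawing_of_def image by (simp add: image_Un image_UN image_comp)
    ultimately show ?thesis
      by simp
  qed
  ultimately show ?thesis
    unfolding c_planar_embedding_def by blast
qed

section \<open>From the partitions to the connected intersections\<close>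

text \<open>Vertices outside \<open>B\<close> or \<open>R\<close> are in the outer face of
  \<open>X K\<close> because \<open>X K\<close> is part of \<open>X B\<close> and
  \<open>X R\<close>. The others are treated by following a walk in \<open>G[B]\<close> to
  \<open>K\<close>, by induction from its end in \<open>K\<close>.\<close>

lemma vertex_outside_component:
  assumes sub: "B \<subseteq> V" "R \<subseteq> V" and con: "connected_in E B"
    and out: "\<And>C v. C \<in> {B, R} \<Longrightarrow> v \<in> V - C \<Longrightarrow> pos v \<in> outside (X C)"
    and K: "K \<in> components_in E (B \<inter> R)" and v: "v \<in> V - K"
  shows "pos v \<in> outside (X K)"
proof -
  have KBR: "K \<subseteq> B \<inter> R"
    using K Union_components_in[of E "B \<inter> R"] by blast
  have outK: "pos w \<in> outside (X K)" if "C \<in> {B, R}" "w \<in> V - C" for w C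
    using out[OF that] outside_mono[OF drawing_of_mono[OF order_refl, of K C E pos curve]] KBR that(1)
    by blast
  obtain c where c: "c \<in> K"
    using K by (auto simp: components_in_def reach_in_def)
  have step: "w \<notin> K \<longrightarrow> pos w \<in> outside (X K)" if "reach_in E B w c" for w
    using that unfolding reach_in_def
  proof (induction rule: converse_rtranclp_induct)
    case base
    then show ?case
      using c by simp
  next
    case (step x y)
    show ?case
    proof
      assume x: "x \<notin> K"
      show "pos x \<in> outside (X K)"
      proof (cases "y \<in> K")
        case True
        \<comment> \<open>The walk stays in \<open>B\<close>, so if \<open>x\<close> were in
          \<open>R\<close>, the edge to \<open>y\<close> would put \<open>x\<close> into the
          component \<open>K\<close>.\<close>
        then have "x \<notin> R"
          using component_absorbs_edge[OF K, of y x] step.hyps x by (auto simp: insert_commute)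
        then show ?thesis
          using outK[of R x] step.hyps sub by blast
      next
        case False
        \<comment> \<open>An edge avoiding \<open>K\<close> does not change the face of
          \<open>X K\<close>, so \<open>x\<close> inherits the outer face from
          \<open>y\<close>.\<close>
        have "reach_in E (V - K) y x"
          using step.hyps sub x False by (auto simp: reach_in_def insert_commute)
        then have "connected_component (- X K) (pos y) (pos x)"
          using reach_in_imp_connected_component[of K y x] KBR sub step.hyps False by blast
        then show ?thesis
          using outside_same_component step.IH False by blast
      qed
    qed
  qed
  show ?thesis
  proof (cases "v \<in> B")
    case True
    then have "reach_in E B v c"
      using con c KBR unfolding connected_in_def by blast
    then show ?thesis
      using step v by blast
  next
    case False
    then show ?thesis
      using outK[of B v] v by blast
  qed
qed

end

text \<open>An empty intersection has no components, so ranging over all pairs gives the same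
  family.\<close>

lemma connected_intersection_partition_iff:
  "K \<in> connected_intersection_partition E PB PR \<longleftrightarrow>
    (\<exists>B\<in>PB. \<exists>R\<in>PR. K \<in> components_in E (B \<inter> R))"
  by (auto simp: connected_intersection_partition_def intersection_partition_def components_in_def)

theorem theorem1:
  fixes V :: "'a set" and E :: "'a set set" and PR PB :: "'a set set"
  assumes "graph V E"
    and "partition_on V PR"
    and "partition_on V PB"
    and "c_co_connected V E (PR \<union> PB)"
  shows "c_planar V E (PR \<union> PB) \<longleftrightarrow>
         c_planar V E (connected_intersection_partition E PB PR)"
proof -
  let ?I = "connected_intersection_partition E PB PR"
  have sub: "C \<subseteq> V" if "C \<in> PR \<union> PB" for C
    using assms(2,3) that unfolding partition_on_def by blast
  have con: "connected_in E C" "connected_in E (V - C)" if "C \<in> PR \<union> PB" for C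
    using assms(4) that unfolding c_co_connected_def by blast+
  have "c_connected V E (PR \<union> PB)" "c_connected V E ?I"
    using con(1) by (auto simp: c_connected_def connected_intersection_partition_iff
        intro: connected_in_component)
  \<comment> \<open>Both sides now speak of drawings of \<open>G\<close> itself.\<close>
  note iffs = this[THEN c_planar_iff_embedding[OF assms(1)]]
  have "c_planar_embedding V E ?I pos curve"
    if emb: "c_planar_embedding V E (PR \<union> PB) pos curve" for pos curve
  proof -
    interpret plane_graph V E pos curve
      using assms(1) emb by unfold_locales (auto simp: c_planar_embedding_def)
    have out: "pos v \<in> outside (X C)" if "C \<in> PR \<union> PB" "v \<in> V - C" for C v
      using emb that unfolding c_planar_embedding_def by blast
    have "pos v \<in> outside (X K)" if K: "K \<in> ?I" "v \<in> V - K" for K v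
    proof -
      obtain B R where BR: "B \<in> PB" "R \<in> PR" and comp: "K \<in> components_in E (B \<inter> R)"
        using K(1) unfolding connected_intersection_partition_iff by blast
      have U: "B \<in> PR \<union> PB" "R \<in> PR \<union> PB"
        using BR by auto
      show ?thesis
      proof (rule vertex_outside_component[OF sub[OF U(1)] sub[OF U(2)] con(1)[OF U(1)] _ comp K(2)])
        show "pos v \<in> outside (X C)" if "C \<in> {B, R}" "v \<in> V - C" for C v
          using out[of C v] that U by blast
      qed
    qed
    then show ?thesis
      using drawing unfolding c_planar_embedding_def by blast
  qed
  moreover have "\<exists>pos curve. c_planar_embedding V E (PR \<union> PB) pos curve"
    if emb: "c_planar_embedding V E ?I pos curve" for pos curve
  proof -
    interpret plane_graph V E pos curve
      using assms(1) emb by unfold_locales (auto simp: c_planar_embedding_def)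
    have "pos v \<in> outside (X K)"
      if "B \<in> PB" "R \<in> PR" "K \<in> components_in E (B \<inter> R)" "v \<in> V - K" for B R K v
    proof -
      have "K \<in> ?I"
        unfolding connected_intersection_partition_iff using that by blast
      then show ?thesis
        using emb that(4) unfolding c_planar_embedding_def by blast
    qed
    then obtain q where q: "\<forall>C\<in>PR \<union> PB - {V}. q \<in> coregion C"
      using common_coregion_point[OF assms(3,2,4)] by blast
    let ?U = "\<Inter>C\<in>PR \<union> PB - {V}. coregion C"
    have "finite (PR \<union> PB)"
      by (rule finite_subset[of _ "Pow V"]) (use sub finite_V in auto)
    then have "open ?U"
      using open_coregion sub by (intro open_INT) auto
    \<comment> \<open>The open set \<open>?U\<close> contains \<open>q\<close>, whereas
      \<open>X V\<close> has empty interior; this gives a centre of inversion off the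
      drawing.\<close>
    then have "\<not> ?U \<subseteq> X V"
      using q interior_maximal[of ?U "X V"] interior_drawing[of V] by auto
    then obtain p where "p \<notin> X V" "\<forall>C\<in>PR \<union> PB - {V}. p \<in> coregion C"
      by blast
    then show ?thesis
      using sub con by (intro c_planar_embedding_inversion) auto
  qed
  ultimately show ?thesis
    unfolding iffs by blast
qed

end
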